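(* Let $m,h,d,l$ be positive integers with $\gcd(m,d)=1$, $m\geq 2$ and $l\leq m-2$, and let $S=\langle m,\, hm+d,\, hm+2d,\ldots, hm+ld\rangle$ be the numerical semigroup generated by this generalized arithmetic sequence. Then $S$ satisfies Wilf's conjecture, that is, $f(S)+1 \leq n(S)\,\nu(S)$.
   Context: $\mathbb{N}$ denotes the natural numbers including $0$. A numerical semigroup is a submonoid $S$ of $(\mathbb{N},+)$ with finite complement in $\mathbb{N}$; $\langle a_1,\ldots,a_r\rangle$ denotes the submonoid of $(\mathbb{N},+)$ generated by $a_1,\ldots,a_r$. The Frobenius number $f(S)$ is the largest integer not belonging to $S$. The embedding dimension $\nu(S)$ is the number of elements of the unique minimal system of generators of $S$. Finally $n(S)=|\{s\in S : s<f(S)\}| = |S\cap[0,f(S)]|$. *)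

theory Defs
  imports Complex_Main
begin

definition nat_submonoid :: "nat set \<Rightarrow> bool" where
  "nat_submonoid S \<longleftrightarrow> 0 \<in> S \<and> (\<forall>x\<in>S. \<forall>y\<in>S. x + y \<in> S)"

definition numerical_semigroup :: "nat set \<Rightarrow> bool" where
  "numerical_semigroup S \<longleftrightarrow> nat_submonoid S \<and> finite (- S)"

definition generated_submonoid :: "nat set \<Rightarrow> nat set" where
  "generated_submonoid A = nat_submonoid hull A"

(* The largest integer, not natural number, outside S: the value is -1 for S = UNIV.
   GREATEST rather than Max, because all negative integers lie outside S. *)
definition frobenius_number :: "nat set \<Rightarrow> int" where
  "frobenius_number S = (GREATEST z. z \<notin> int ` S)"

definition minimal_generating_system :: "nat set \<Rightarrow> nat set \<Rightarrow> bool" where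
  "minimal_generating_system S A \<longleftrightarrow>
     generated_submonoid A = S \<and> (\<forall>B. B \<subset> A \<longrightarrow> generated_submonoid B \<noteq> S)"

definition embedding_dimension :: "nat set \<Rightarrow> nat" where
  "embedding_dimension S = card (THE A. minimal_generating_system S A)"

definition num_below_frobenius :: "nat set \<Rightarrow> nat" where
  "num_below_frobenius S = card {s \<in> S. int s < frobenius_number S}"

definition satisfies_wilf :: "nat set \<Rightarrow> bool" where
  "satisfies_wilf S \<longleftrightarrow>
     frobenius_number S + 1 \<le> int (num_below_frobenius S) * int (embedding_dimension S)"

end

theory Submission
  imports Defs "HOL-Number_Theory.Cong"
begin

text \<open>
  Write \<open>c t\<close> for the ceiling of \<open>t / l\<close>. A sum of \<open>j\<close> generators of the form
  \<open>h m + i d\<close> with \<open>1 \<le> i \<le> l\<close> is \<open>j h m + t d\<close> with \<open>j \<le> t \<le> j l\<close>, and the least possible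
  \<open>j\<close> for a given \<open>t\<close> is \<open>c t\<close>. So \<open>S\<close> consists of the numbers \<open>k m + t d\<close> with \<open>h c(t) \<le> k\<close>
  (\<open>generated_eq_elements\<close>), and the least element of \<open>S\<close> in the residue class of
  \<open>t d\<close>, for \<open>t < m\<close>, is \<open>w t = h c(t) m + t d\<close>. These Apery elements increase with \<open>t\<close>,
  hence the Frobenius number is \<open>w (m - 1) - m\<close> (\<open>frobenius_number_elements\<close>). The generators are
  irreducible, so the embedding dimension is \<open>l + 1\<close> (\<open>embedding_dimension_elements\<close>).

  Put \<open>q = c (m - 1)\<close>. Counting the elements below the Frobenius number class by class gives at
  least \<open>h B + A\<close> of them, where \<open>B\<close> is the sum of \<open>q - c t\<close> and \<open>A\<close> the sum of
  \<open>\<lfloor>t d / m\<rfloor>\<close> over \<open>t < m\<close>, whereas the Frobenius number plus one is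
  \<open>h q m + (m - 1) (d - 1)\<close>. Wilf's inequality then splits into two independent ones. The part
  linear in \<open>d\<close> is \<open>(m - 1) (d - 1) \<le> 2 A\<close>, by pairing \<open>t\<close> with \<open>m - t\<close>
  (\<open>floor_sum_lower_bound\<close>), and \<open>2 \<le> l + 1\<close>. The part linear in \<open>h\<close> is
  \<open>q m \<le> (l + 1) B\<close> (\<open>ceiling_deficit_bound\<close>), which follows from \<open>m \<le> q l + 1\<close> and
  \<open>2 B \<ge> q (2 + (q - 1) l)\<close>.
\<close>

section \<open>Submonoids and minimal generators\<close>

lemma generated_submonoid_least:
  "A \<subseteq> T \<Longrightarrow> nat_submonoid T \<Longrightarrow> generated_submonoid A \<subseteq> T"
  unfolding generated_submonoid_def by (rule hull_minimal)

lemma subset_generated_submonoid: "A \<subseteq> generated_submonoid A"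
  unfolding generated_submonoid_def by (rule hull_subset)

lemma nat_submonoid_generated: "nat_submonoid (generated_submonoid A)"
proof -
  have "nat_submonoid (nat_submonoid hull A)"
    by (rule hull_in) (auto simp: nat_submonoid_def)
  thus ?thesis by (simp add: generated_submonoid_def)
qed

text \<open>
  That \<open>S - {x}\<close> is a submonoid says that \<open>x\<close> is irreducible in \<open>S\<close>. A generating system cannot
  avoid such an \<open>x\<close>, for otherwise it would generate a part of \<open>S - {x}\<close>. Hence a generating
  system of irreducible elements lies in every other one, and it is the only minimal one.
\<close>

lemma embedding_dimension_irreducible_generators:
  assumes gen: "generated_submonoid G = S"
    and irred: "\<And>x. x \<in> G \<Longrightarrow> nat_submonoid (S - {x})"
  shows "embedding_dimension S = card G"
proof -
  have least: "G \<subseteq> B" if B: "generated_submonoid B = S" for B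
  proof
    fix x assume x: "x \<in> G"
    show "x \<in> B"
    proof (rule ccontr)
      assume "x \<notin> B"
      hence "B \<subseteq> S - {x}" using subset_generated_submonoid[of B] B by auto
      hence "S \<subseteq> S - {x}" using generated_submonoid_least[OF _ irred[OF x], of B] B by auto
      thus False using subset_generated_submonoid[of G] gen x by auto
    qed
  qed
  have "(THE A. minimal_generating_system S A) = G"
  proof (rule the_equality)
    show "minimal_generating_system S G"
      unfolding minimal_generating_system_def using gen least by blast
  next
    fix B assume "minimal_generating_system S B"
    thus "B = G" unfolding minimal_generating_system_def using gen least by blast
  qed
  thus ?thesis by (simp add: embedding_dimension_def)
qed

section \<open>Ceiling division\<close>

definition ceil_div :: "nat \<Rightarrow> nat \<Rightarrow> nat" where
  "ceil_div l t = (t + l - 1) div l"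

text \<open>This Galois connection characterises \<open>ceil_div\<close>, and everything below follows from it.\<close>

lemma ceil_div_le_iff: "l > 0 \<Longrightarrow> ceil_div l t \<le> p \<longleftrightarrow> t \<le> p * l"
proof -
  assume l: "l > 0"
  have "ceil_div l t \<le> p \<longleftrightarrow> (t + l - 1) div l < Suc p" by (auto simp: ceil_div_def)
  also have "\<dots> \<longleftrightarrow> t + l - 1 < Suc p * l" by (rule div_less_iff_less_mult[OF l])
  also have "\<dots> \<longleftrightarrow> t \<le> p * l" using l by auto
  finally show ?thesis .
qed

lemma le_ceil_div_mult: "l > 0 \<Longrightarrow> t \<le> ceil_div l t * l"
  using ceil_div_le_iff[of l t "ceil_div l t"] by simp

lemma ceil_div_0 [simp]: "l > 0 \<Longrightarrow> ceil_div l 0 = 0"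
  using ceil_div_le_iff[of l 0 0] by simp

lemma ceil_div_pos: "l > 0 \<Longrightarrow> t > 0 \<Longrightarrow> ceil_div l t \<ge> 1"
  using ceil_div_le_iff[of l t 0] by simp

lemma ceil_div_mono: "l > 0 \<Longrightarrow> s \<le> t \<Longrightarrow> ceil_div l s \<le> ceil_div l t"
  using ceil_div_le_iff le_ceil_div_mult order_trans by blast

lemma ceil_div_add_le: "l > 0 \<Longrightarrow> ceil_div l (s + t) \<le> ceil_div l s + ceil_div l t"
  by (simp add: ceil_div_le_iff add_mult_distrib add_mono le_ceil_div_mult)

lemma ceil_div_diff:
  assumes "l > 0" "t > 0"
  shows "ceil_div l (t - min t l) + 1 \<le> ceil_div l t"
proof -
  have "t - min t l \<le> (ceil_div l t - 1) * l"
    using le_ceil_div_mult[OF assms(1), of t] by (auto simp: diff_mult_distrib min_def)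
  hence "ceil_div l (t - min t l) \<le> ceil_div l t - 1" by (simp add: ceil_div_le_iff assms)
  with ceil_div_pos[OF assms] show ?thesis by linarith
qed

section \<open>A ceiling sum and a floor sum\<close>

text \<open>
  Raising \<open>Q\<close> by one adds one to each of the \<open>Q l + 1\<close> terms, and there are \<open>l\<close> new terms, each
  at least one.
\<close>

lemma ceiling_deficit_sum:
  assumes l: "l > 0"
  shows "Suc Q * (2 + Q * l) \<le> 2 * (\<Sum>t\<le>Q * l. Suc Q - ceil_div l t)"
proof -
  define F where "F Q = (\<Sum>t\<le>Q * l. Suc Q - ceil_div l t)" for Q
  have step: "F Q + (Suc (Q * l) + l) \<le> F (Suc Q)" for Q
  proof -
    let ?old = "{..Q * l}" and ?new = "{Q * l<..Suc Q * l}"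
    let ?f = "\<lambda>t. Suc (Suc Q) - ceil_div l t"
    have "sum ?f ?old = (\<Sum>t\<in>?old. (Suc Q - ceil_div l t) + 1)"
    proof (rule sum.cong[OF refl])
      fix t assume "t \<in> ?old"
      hence "ceil_div l t \<le> Q" by (simp add: ceil_div_le_iff l)
      thus "?f t = (Suc Q - ceil_div l t) + 1" by simp
    qed
    also have "\<dots> = F Q + (\<Sum>t\<in>?old. 1)" unfolding F_def by (rule sum.distrib)
    finally have old: "F Q + Suc (Q * l) \<le> sum ?f ?old" by simp
    have "(\<Sum>t\<in>?new. 1) \<le> sum ?f ?new"
    proof (rule sum_mono)
      fix t assume "t \<in> ?new"
      hence "ceil_div l t \<le> Suc Q" using l by (simp only: ceil_div_le_iff) simp
      thus "1 \<le> ?f t" by simp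
    qed
    hence new: "l \<le> sum ?f ?new" by simp
    have "F (Suc Q) = sum ?f (?old \<union> ?new)"
      unfolding F_def by (rule sum.cong) auto
    also have "\<dots> = sum ?f ?old + sum ?f ?new" by (rule sum.union_disjoint) auto
    finally show ?thesis using add_mono[OF old new] by (simp only: add.assoc)
  qed
  have "Suc Q * (2 + Q * l) \<le> 2 * F Q"
  proof (induction Q)
    case 0
    show ?case using l by (simp add: F_def)
  next
    case (Suc Q)
    have "Suc (Suc Q) * (2 + Suc Q * l) = Suc Q * (2 + Q * l) + 2 * (Suc (Q * l) + l)"
      by (simp add: algebra_simps)
    also have "\<dots> \<le> 2 * F Q + 2 * (Suc (Q * l) + l)" using Suc.IH by (rule add_right_mono)
    also have "\<dots> = 2 * (F Q + (Suc (Q * l) + l))" by (simp only: add_mult_distrib2)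
    also have "\<dots> \<le> 2 * F (Suc Q)" using step by (rule mult_left_mono) simp
    finally show ?case .
  qed
  thus ?thesis by (simp add: F_def)
qed

text \<open>
  With \<open>q = Q + 1\<close> the terms with \<open>t \<le> Q l\<close> already suffice: the remaining ones vanish.
  The claim is tight for \<open>l = 1\<close>.
\<close>

lemma ceiling_deficit_bound:
  assumes l: "l > 0" and m: "m \<ge> 2"
  defines "q \<equiv> ceil_div l (m - 1)"
  shows "q * m \<le> (l + 1) * (\<Sum>t<m. q - ceil_div l t)"
proof -
  have "q \<ge> 1" unfolding q_def using l m by (intro ceil_div_pos) auto
  then obtain Q where Q: "q = Suc Q" by (cases q) auto
  have m_le: "m \<le> q * l + 1" using le_ceil_div_mult[OF l, of "m - 1"] by (simp add: q_def)
  have "Q * l < m - 1" using ceil_div_le_iff[OF l, of "m - 1" Q] Q by (simp add: q_def)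
  hence sub: "{..Q * l} \<subseteq> {..<m}" by auto
  let ?B = "\<Sum>t<m. q - ceil_div l t"
  have "(\<Sum>t\<le>Q * l. q - ceil_div l t) \<le> ?B" by (rule sum_mono2) (use sub in auto)
  hence B: "q * (2 + Q * l) \<le> 2 * ?B" using ceiling_deficit_sum[OF l, of Q] Q by simp
  have "Q * l * 1 \<le> Q * l * l" using l by (intro mult_left_mono) auto
  hence "2 * (q * l + 1) \<le> (l + 1) * (2 + Q * l)" using Q by (simp add: algebra_simps)
  hence "q * (2 * (q * l + 1)) \<le> q * ((l + 1) * (2 + Q * l))" by (rule mult_left_mono) simp
  also have "\<dots> = (l + 1) * (q * (2 + Q * l))" by (simp only: mult.left_commute)
  also have "\<dots> \<le> (l + 1) * (2 * ?B)" using B by (rule mult_left_mono) simp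
  finally have "q * (q * l + 1) \<le> (l + 1) * ?B" by simp
  moreover have "q * m \<le> q * (q * l + 1)" using m_le by (rule mult_left_mono) simp
  ultimately show ?thesis by linarith
qed

text \<open>
  Pair \<open>t\<close> with \<open>m - t\<close>: the two fractions add up to \<open>d\<close>, and each floor loses less than one.
\<close>

lemma floor_sum_lower_bound:
  fixes m d :: nat
  assumes m: "m > 0"
  shows "(m - 1) * (d - 1) \<le> 2 * (\<Sum>t<m. t * d div m)"
proof -
  obtain M where M: "m = Suc M" using m by (cases m) auto
  let ?g = "\<lambda>t. Suc t * d div m"
  have shift: "(\<Sum>t<m. t * d div m) = (\<Sum>t<M. ?g t)"
    unfolding M sum.lessThan_Suc_shift by simp
  have "(\<Sum>t<M. d - 1) \<le> (\<Sum>t<M. ?g t + ?g (M - Suc t))"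
  proof (rule sum_mono)
    fix t assume "t \<in> {..<M}"
    hence "Suc t + Suc (M - Suc t) = m" using M by simp
    hence "Suc t * d + Suc (M - Suc t) * d = d * m" by (metis add_mult_distrib mult.commute)
    moreover have "Suc t * d < Suc (?g t) * m" "Suc (M - Suc t) * d < Suc (?g (M - Suc t)) * m"
      using m by (simp_all only: div_less_iff_less_mult[symmetric] lessI)
    ultimately have "d * m < (Suc (?g t) + Suc (?g (M - Suc t))) * m"
      by (simp only: add_mult_distrib)
    hence "d < Suc (?g t) + Suc (?g (M - Suc t))" by (simp only: mult_less_cancel2)
    thus "d - 1 \<le> ?g t + ?g (M - Suc t)" by linarith
  qed
  also have "\<dots> = 2 * (\<Sum>t<M. ?g t)"
    by (simp only: sum.distrib sum.nat_diff_reindex[of ?g M] mult_2)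
  finally show ?thesis using shift M by simp
qed

section \<open>The semigroup of a generalized arithmetic sequence\<close>

locale generalized_arithmetic_sequence =
  fixes m h d l :: nat
  assumes h: "h > 0" and d: "d > 0" and l: "l > 0" and l_less: "l < m"
    and coprime: "coprime m d"
begin

abbreviation c :: "nat \<Rightarrow> nat" where "c \<equiv> ceil_div l"

definition generators :: "nat set" where
  "generators = {m} \<union> (\<lambda>i. h * m + i * d) ` {1..l}"

definition elements :: "nat set" where
  "elements = {k * m + t * d | k t. h * c t \<le> k}"

definition apery :: "nat \<Rightarrow> nat" where
  "apery t = h * c t * m + t * d"

lemma m_pos: "m > 0"
  using l_less by simp

lemma elementsI: "h * c t \<le> k \<Longrightarrow> k * m + t * d \<in> elements"
  by (auto simp: elements_def)

lemma nat_submonoid_elements: "nat_submonoid elements"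
  unfolding nat_submonoid_def
proof (intro conjI ballI)
  show "0 \<in> elements" using elementsI[of 0 0] l by simp
next
  fix x y assume "x \<in> elements" "y \<in> elements"
  then obtain k t k' t' where x: "x = k * m + t * d" "h * c t \<le> k"
    and y: "y = k' * m + t' * d" "h * c t' \<le> k'" by (auto simp: elements_def)
  have "h * c (t + t') \<le> h * (c t + c t')" using ceil_div_add_le[OF l] by (rule mult_left_mono) simp
  also have "\<dots> \<le> k + k'" using x y by (simp add: algebra_simps)
  finally have "(k + k') * m + (t + t') * d \<in> elements" by (rule elementsI)
  thus "x + y \<in> elements" using x y by (simp add: algebra_simps)
qed

lemma generators_subset: "generators \<subseteq> elements"
proof -
  have "m \<in> elements" using elementsI[of 0 1] l by simp
  moreover have "h * m + i * d \<in> elements" if "i \<in> {1..l}" for i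
  proof (rule elementsI)
    have "c i \<le> 1" using that l by (simp add: ceil_div_le_iff)
    thus "h * c i \<le> h" by simp
  qed
  ultimately show ?thesis by (auto simp: generators_def)
qed

text \<open>
  Greedy decomposition: splitting off the generator \<open>h m + min t l * d\<close> lowers \<open>c t\<close> by one, which
  pays for the \<open>h\<close> copies of \<open>m\<close> it uses.
\<close>

lemma elements_subset: "elements \<subseteq> generated_submonoid generators"
proof -
  let ?S = "generated_submonoid generators"
  have zero: "0 \<in> ?S" and add: "\<And>x y. x \<in> ?S \<Longrightarrow> y \<in> ?S \<Longrightarrow> x + y \<in> ?S"
    using nat_submonoid_generated[of generators] by (auto simp: nat_submonoid_def)
  have gen: "x \<in> ?S" if "x \<in> generators" for x
    using that subset_generated_submonoid by blast
  have "m \<in> ?S" by (rule gen) (simp add: generators_def)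
  hence multiples: "k * m \<in> ?S" for k
    by (induction k) (auto intro: zero add)
  have "k * m + t * d \<in> ?S" if "h * c t \<le> k" for k t
    using that
  proof (induction t arbitrary: k rule: less_induct)
    case (less t)
    show ?case
    proof (cases "t = 0")
      case True
      thus ?thesis using multiples by simp
    next
      case False
      define i where "i = min t l"
      have i: "i \<in> {1..l}" "i \<le> t" using False l by (auto simp: i_def)
      have "h * (c (t - i) + 1) \<le> h * c t"
        using ceil_div_diff[OF l, of t] False unfolding i_def by (intro mult_left_mono) auto
      hence le: "h * c (t - i) + h \<le> k" using less.prems by simp
      have "(k - h) * m + (t - i) * d \<in> ?S" using le i by (intro less.IH) auto
      moreover have "h * m + i * d \<in> ?S" using i by (intro gen) (auto simp: generators_def)
      ultimately have "((k - h) * m + (t - i) * d) + (h * m + i * d) \<in> ?S" by (rule add)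
      moreover have "((k - h) * m + (t - i) * d) + (h * m + i * d)
          = ((k - h) + h) * m + ((t - i) + i) * d"
        by (simp only: add_mult_distrib add_mult_distrib2 ac_simps)
      ultimately show ?thesis using le i by simp
    qed
  qed
  thus ?thesis by (auto simp: elements_def)
qed

lemma generated_eq_elements: "generated_submonoid generators = elements"
  using generated_submonoid_least[OF generators_subset nat_submonoid_elements] elements_subset
  by blast

section \<open>Apery elements and the Frobenius number\<close>

lemma apery_add_mem: "apery t + j * m \<in> elements"
  using elementsI[of t "h * c t + j"] by (simp add: apery_def algebra_simps)

text \<open>Replacing \<open>t\<close> by \<open>t - m\<close> turns \<open>m d\<close> into \<open>d\<close> copies of \<open>m\<close> and does not raise \<open>c t\<close>.\<close>

lemma elements_apery:
  assumes "x \<in> elements"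
  obtains t j where "t < m" "x = apery t + j * m"
proof -
  obtain k t where x: "x = k * m + t * d" and k: "h * c t \<le> k"
    using assms by (auto simp: elements_def)
  define s where "s = t mod m"
  define p where "p = t div m"
  have t: "t = s + p * m" by (simp add: s_def p_def)
  have "h * c s \<le> h * c t" using ceil_div_mono[OF l, of s t] t by simp
  hence "h * c s \<le> k" using k by linarith
  then obtain j where j: "k = h * c s + j" using le_Suc_ex by blast
  have "x = apery s + (j + p * d) * m" unfolding x t j apery_def by (simp add: algebra_simps)
  moreover have "s < m" using m_pos by (simp add: s_def)
  ultimately show thesis using that by blast
qed

lemma apery_residue: "apery t mod m = t * d mod m"
  by (simp add: apery_def)

lemma apery_residue_inj:
  assumes "s < m" "t < m" "(apery s + i * m) mod m = (apery t + j * m) mod m"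
  shows "s = t"
proof -
  have "[s * d = t * d] (mod m)" using assms(3) by (simp add: cong_def apery_residue)
  hence "[s = t] (mod m)" using cong_mult_rcancel_nat[of d m] coprime
    by (simp add: coprime_commute)
  thus ?thesis using assms by (simp add: cong_def)
qed

lemma residue_surj: "\<exists>t<m. t * d mod m = x mod m"
proof -
  obtain e where e: "[d * e = 1] (mod m)"
    using coprime cong_solve_coprime_nat[of d m] by (auto simp: coprime_commute)
  have "(x * e mod m) * d mod m = x * e * d mod m" by (rule mod_mult_left_eq)
  also have "\<dots> = x * (d * e) mod m" by (simp only: ac_simps)
  also have "\<dots> = x mod m" using cong_scalar_left[OF e, of x] by (simp add: cong_def)
  finally show ?thesis using m_pos by (intro exI[of _ "x * e mod m"]) auto
qed

lemma apery_mono: "s \<le> t \<Longrightarrow> apery s \<le> apery t"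
  unfolding apery_def by (intro add_mono mult_le_mono ceil_div_mono l) auto

lemma m_le_apery_last: "m \<ge> 2 \<Longrightarrow> m \<le> apery (m - 1)"
proof -
  assume "m \<ge> 2"
  hence "1 * 1 * m \<le> h * c (m - 1) * m"
    using h ceil_div_pos[OF l, of "m - 1"] by (intro mult_le_mono) auto
  hence "m \<le> h * c (m - 1) * m" by (simp only: mult_1_left)
  thus ?thesis unfolding apery_def by (rule trans_le_add1)
qed

lemma mem_of_large:
  assumes "apery (m - 1) < x + m"
  shows "x \<in> elements"
proof -
  obtain t where t: "t < m" "t * d mod m = x mod m" using residue_surj by blast
  hence r: "apery t mod m = x mod m" by (simp add: apery_residue)
  have "apery t \<le> apery (m - 1)" using t by (intro apery_mono) auto
  hence less: "apery t < x + m" using assms by (rule le_less_trans)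
  have "apery t \<le> x"
  proof (rule ccontr)
    assume "\<not> apery t \<le> x"
    hence "m dvd apery t - x" "0 < apery t - x" using r by (auto simp: mod_eq_dvd_iff_nat)
    hence "m \<le> apery t - x" by (rule dvd_imp_le)
    thus False using less m_pos by linarith
  qed
  hence "m dvd x - apery t" using r[symmetric] by (simp add: mod_eq_dvd_iff_nat)
  then obtain j where "x - apery t = j * m" by (metis dvd_def mult.commute)
  hence "x = apery t + j * m" using \<open>apery t \<le> x\<close> by linarith
  thus ?thesis using apery_add_mem by simp
qed

lemma apery_last_gap:
  assumes "x + m = apery (m - 1)"
  shows "x \<notin> elements"
proof
  assume "x \<in> elements"
  then obtain t j where t: "t < m" "x = apery t + j * m" by (rule elements_apery)
  hence eq: "apery t + Suc j * m = apery (m - 1) + 0 * m" using assms by simp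
  hence "t = m - 1" using t m_pos by (intro apery_residue_inj[of t "m - 1" "Suc j" 0]) auto
  thus False using eq m_pos by simp
qed

lemma numerical_semigroup_elements: "numerical_semigroup elements"
proof -
  have "- elements \<subseteq> {..apery (m - 1)}"
  proof
    fix x assume "x \<in> - elements"
    thus "x \<in> {..apery (m - 1)}" using mem_of_large[of x] m_pos by force
  qed
  thus ?thesis
    using nat_submonoid_elements by (auto simp: numerical_semigroup_def intro: finite_subset)
qed

lemma frobenius_number_elements:
  assumes "m \<ge> 2"
  shows "frobenius_number elements = int (apery (m - 1) - m)"
  unfolding frobenius_number_def
proof (rule Greatest_equality)
  show "int (apery (m - 1) - m) \<notin> int ` elements"
    using apery_last_gap m_le_apery_last[OF assms] by auto
next
  fix z assume z: "z \<notin> int ` elements"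
  show "z \<le> int (apery (m - 1) - m)"
  proof (rule ccontr)
    assume "\<not> ?thesis"
    hence "0 \<le> z" "int (apery (m - 1)) < z + int m" by linarith+
    hence "nat z \<in> elements" by (intro mem_of_large) linarith
    hence "z \<in> int ` elements" using \<open>0 \<le> z\<close> by (metis image_eqI nat_0_le)
    with z show False by simp
  qed
qed

section \<open>Counting the elements below the Frobenius number\<close>

lemma apery_deficit:
  assumes "t < m"
  shows "(apery (m - 1) - apery t) div m
    = h * (c (m - 1) - c t) + (m - Suc t) * d div m"
proof -
  have le: "c t \<le> c (m - 1)" using assms by (intro ceil_div_mono l) auto
  then obtain e where e: "c (m - 1) = c t + e" using le_Suc_ex by blast
  have "m - 1 = t + (m - Suc t)" using assms by simp
  hence t: "(m - 1) * d = t * d + (m - Suc t) * d" by (metis add_mult_distrib)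
  have "apery (m - 1) = apery t + ((m - Suc t) * d + h * e * m)"
    unfolding apery_def e t by (simp only: add_mult_distrib add_mult_distrib2 ac_simps)
  hence "(apery (m - 1) - apery t) div m = ((m - Suc t) * d + h * e * m) div m" by simp
  thus ?thesis unfolding e using m_pos by simp
qed

lemma sum_apery_deficit:
  "(\<Sum>t<m. (apery (m - 1) - apery t) div m)
    = h * (\<Sum>t<m. c (m - 1) - c t) + (\<Sum>t<m. t * d div m)"
proof -
  have "(\<Sum>t<m. (apery (m - 1) - apery t) div m)
      = (\<Sum>t<m. h * (c (m - 1) - c t) + (m - Suc t) * d div m)"
    by (intro sum.cong refl apery_deficit) simp
  also have "\<dots> = h * (\<Sum>t<m. c (m - 1) - c t) + (\<Sum>t<m. (m - Suc t) * d div m)"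
    by (simp only: sum.distrib sum_distrib_left)
  also have "(\<Sum>t<m. (m - Suc t) * d div m) = (\<Sum>t<m. t * d div m)"
    by (rule sum.nat_diff_reindex)
  finally show ?thesis .
qed

text \<open>
  In the class of \<open>t d\<close> the elements below \<open>apery (m - 1) - m\<close> are \<open>apery t + j m\<close> with
  \<open>j < (apery (m - 1) - apery t) div m\<close>, and distinct classes are disjoint.
\<close>

lemma num_below_frobenius_elements:
  assumes "m \<ge> 2"
  shows "(\<Sum>t<m. (apery (m - 1) - apery t) div m) \<le> num_below_frobenius elements"
proof -
  let ?W = "apery (m - 1)"
  let ?I = "SIGMA t:{..<m}. {..<(?W - apery t) div m}"
  let ?f = "\<lambda>(t, j). apery t + j * m"
  let ?N = "{s \<in> elements. int s < frobenius_number elements}"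
  have inj: "inj_on ?f ?I"
  proof (rule inj_onI)
    fix a b assume ab: "a \<in> ?I" "b \<in> ?I" "?f a = ?f b"
    obtain s i where a: "a = (s, i)" by (cases a)
    obtain t j where b: "b = (t, j)" by (cases b)
    have st: "s \<in> {..<m}" "t \<in> {..<m}" and eq: "apery s + i * m = apery t + j * m"
      using ab a b by auto
    from eq have "(apery s + i * m) mod m = (apery t + j * m) mod m" by (rule arg_cong)
    with st have "s = t" using apery_residue_inj[of s t i j] by simp
    with eq show "a = b" using m_pos a b by simp
  qed
  have image: "?f ` ?I \<subseteq> ?N"
  proof
    fix x assume "x \<in> ?f ` ?I"
    then obtain t j where t: "t \<in> {..<m}" and j: "j \<in> {..<(?W - apery t) div m}"
      and x: "x = apery t + j * m" by auto
    have "Suc j * m \<le> (?W - apery t) div m * m" using j by (intro mult_le_mono1) auto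
    also have "\<dots> \<le> ?W - apery t" by (rule div_times_less_eq_dividend)
    finally have "Suc j * m \<le> ?W - apery t" .
    moreover have "apery t \<le> ?W" using t by (intro apery_mono) auto
    ultimately have "apery t + j * m + m \<le> ?W" by simp
    moreover have "apery t + j * m + m \<noteq> ?W" using apery_last_gap apery_add_mem by blast
    ultimately have "int (apery t + j * m) < frobenius_number elements"
      unfolding frobenius_number_elements[OF assms] by linarith
    thus "x \<in> ?N" using apery_add_mem x by blast
  qed
  have "?N \<subseteq> {..<?W}" by (auto simp: frobenius_number_elements[OF assms])
  hence "finite ?N" by (rule finite_subset) simp
  hence "card ?I \<le> card ?N" using inj image by (intro card_inj_on_le) auto
  thus ?thesis by (simp add: num_below_frobenius_def)
qed

section \<open>Embedding dimension\<close>

lemma element_eq_0_or_ge: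
  assumes "x \<in> elements"
  shows "x = 0 \<or> m \<le> x"
proof -
  obtain k t where x: "x = k * m + t * d" "h * c t \<le> k" using assms by (auto simp: elements_def)
  have "k > 0" if "t > 0"
    using x(2) h ceil_div_pos[OF l that] by (cases k) auto
  thus ?thesis using x(1) by (cases k) auto
qed

text \<open>
  Suppose \<open>h m + i d = (k m + t d) + (k' m + t' d)\<close>. As \<open>i < m\<close>, comparing residues gives
  \<open>t + t' = i + p m\<close> with \<open>p \<ge> 0\<close>, hence \<open>k + k' + p d = h\<close>. But a summand with positive
  \<open>t\<close> costs \<open>k \<ge> h\<close>, so exactly one summand has positive \<open>t\<close>, and the other one is \<open>0\<close>.
\<close>

lemma generator_irreducible:
  assumes i: "i \<in> {1..l}" and xy: "x \<in> elements" "y \<in> elements"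
    and sum: "x + y = h * m + i * d"
  shows "x = 0 \<or> y = 0"
proof -
  obtain k t where x: "x = k * m + t * d" "h * c t \<le> k" using xy by (auto simp: elements_def)
  obtain k' t' where y: "y = k' * m + t' * d" "h * c t' \<le> k'" using xy by (auto simp: elements_def)
  have eq: "(k + k') * m + (t + t') * d = h * m + i * d"
    using sum x y by (simp add: algebra_simps)
  hence "((k + k') * m + (t + t') * d) mod m = (h * m + i * d) mod m" by simp
  hence "[(t + t') * d = i * d] (mod m)" by (simp add: cong_def)
  hence "[t + t' = i] (mod m)" using cong_mult_rcancel_nat[of d m] coprime
    by (simp add: coprime_commute)
  hence "(t + t') mod m = i" using i l_less by (simp add: cong_def)
  then obtain p where p: "t + t' = i + p * m" by (metis add.commute div_mult_mod_eq)
  have "(k + k' + p * d) * m = h * m" using eq unfolding p by (simp add: algebra_simps)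
  hence k: "k + k' + p * d = h" using m_pos by simp
  have hk: "h \<le> k" if "t > 0"
    using order_trans[OF mult_le_mono2[OF ceil_div_pos[OF l that], of h] x(2)] by simp
  have hk': "h \<le> k'" if "t' > 0"
    using order_trans[OF mult_le_mono2[OF ceil_div_pos[OF l that], of h] y(2)] by simp
  have "t > 0 \<or> t' > 0" using p i by auto
  then consider "t > 0" "t' = 0" | "t = 0" "t' > 0" | "t > 0" "t' > 0" by auto
  thus ?thesis
  proof cases
    case 1
    with hk k have "k' = 0" by linarith
    with 1 y show ?thesis by simp
  next
    case 2
    with hk' k have "k = 0" by linarith
    with 2 x show ?thesis by simp
  next
    case 3
    with hk hk' k h show ?thesis by linarith
  qed
qed

lemma card_generators: "card generators = l + 1"
proof -
  have "inj_on (\<lambda>i. h * m + i * d) {1..l}" using d by (auto simp: inj_on_def)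
  hence "card ((\<lambda>i. h * m + i * d) ` {1..l}) = l" by (simp add: card_image)
  moreover have "m < h * m + i * d" if "i \<ge> 1" for i
  proof -
    have "1 * m \<le> h * m" using h by (intro mult_le_mono1) auto
    moreover have "0 < i * d" using that d by simp
    ultimately show ?thesis by linarith
  qed
  hence "m \<notin> (\<lambda>i. h * m + i * d) ` {1..l}" by force
  ultimately show ?thesis by (simp add: generators_def)
qed

lemma embedding_dimension_elements: "embedding_dimension elements = l + 1"
proof -
  have "nat_submonoid (elements - {g})" if g: "g \<in> generators" for g
  proof -
    have "g > 0" using g m_pos h by (auto simp: generators_def)
    have irred: "x = 0 \<or> y = 0" if "x \<in> elements" "y \<in> elements" "x + y = g" for x y
    proof (cases "g = m")
      case True
      show ?thesis
        using element_eq_0_or_ge[OF that(1)] element_eq_0_or_ge[OF that(2)] that(3) True m_pos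
        by linarith
    next
      case False
      then obtain i where "i \<in> {1..l}" "g = h * m + i * d" using g by (auto simp: generators_def)
      thus ?thesis using generator_irreducible that by blast
    qed
    show ?thesis
      unfolding nat_submonoid_def
    proof (intro conjI ballI)
      show "0 \<in> elements - {g}"
        using nat_submonoid_elements \<open>g > 0\<close> by (simp add: nat_submonoid_def)
    next
      fix x y assume xy: "x \<in> elements - {g}" "y \<in> elements - {g}"
      hence "x + y \<in> elements" using nat_submonoid_elements by (simp add: nat_submonoid_def)
      moreover have "x + y \<noteq> g" using irred[of x y] xy by auto
      ultimately show "x + y \<in> elements - {g}" by simp
    qed
  qed
  hence "embedding_dimension elements = card generators"
    by (rule embedding_dimension_irreducible_generators[OF generated_eq_elements])
  thus ?thesis by (simp add: card_generators)
qed

section \<open>Wilf's inequality\<close>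

lemma satisfies_wilf_elements:
  assumes m: "m \<ge> 2"
  shows "satisfies_wilf elements"
proof -
  let ?q = "c (m - 1)"
  let ?A = "\<Sum>t<m. t * d div m"
  let ?B = "\<Sum>t<m. ?q - c t"
  let ?n = "num_below_frobenius elements"
  have "(m - 1) * d = (m - 1) * (d - 1) + (m - 1)" using d by (cases d) auto
  hence "apery (m - 1) + 1 = h * (?q * m) + (m - 1) * (d - 1) + m"
    using m by (simp add: apery_def)
  hence "apery (m - 1) - m + 1 = h * (?q * m) + (m - 1) * (d - 1)"
    using m_le_apery_last[OF m] by linarith
  also have "\<dots> \<le> h * ((l + 1) * ?B) + 2 * ?A"
    using ceiling_deficit_bound[OF l m] floor_sum_lower_bound[OF m_pos]
    by (intro add_mono mult_left_mono) auto
  also have "\<dots> \<le> h * ((l + 1) * ?B) + (l + 1) * ?A"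
    using l by (intro add_left_mono mult_right_mono) auto
  also have "\<dots> = (h * ?B + ?A) * (l + 1)" by (simp add: algebra_simps)
  also have "\<dots> \<le> ?n * (l + 1)"
    using num_below_frobenius_elements[OF m] unfolding sum_apery_deficit
    by (rule mult_le_mono1)
  finally have "int (apery (m - 1) - m + 1) \<le> int (?n * (l + 1))" by (simp only: of_nat_le_iff)
  thus ?thesis
    unfolding satisfies_wilf_def frobenius_number_elements[OF m] embedding_dimension_elements
    by (simp only: of_nat_add of_nat_mult of_nat_1)
qed

end

theorem proposition20:
  fixes m h d l :: nat and S :: "nat set"
  assumes "m > 0" and "h > 0" and "d > 0" and "l > 0"
    and "gcd m d = 1" and "m \<ge> 2" and "l \<le> m - 2"
    and "S = generated_submonoid ({m} \<union> (\<lambda>i. h * m + i * d) ` {1..l})"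
  shows "numerical_semigroup S \<and> satisfies_wilf S"
proof -
  interpret generalized_arithmetic_sequence m h d l
    using assms by unfold_locales (auto simp: coprime_iff_gcd_eq_1)
  have "S = elements" using assms(8) generated_eq_elements by (simp add: generators_def)
  thus ?thesis using numerical_semigroup_elements satisfies_wilf_elements assms(6) by simp
qed

end
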